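(* Let $U_1,\dots,U_m\subset\mathbb{R}^n$ be closed convex sets with $S:=\bigcap_{i=1}^mU_i\neq\varnothing$, and let $\varepsilon\in[0,1)$. For each $x\in\mathbb{R}^n$ and each $i$, let $\widehat P_{U_i}x$ be an $\varepsilon$-approximate projection of $x$ onto $U_i$, let $$\widehat H_i(x):=\{y\in\mathbb{R}^n:\langle x-\widehat P_{U_i}x,\;y-\widehat P_{U_i}x\rangle\le0\},\qquad \widehat\Omega(x):=\bigcap_{i=1}^m\widehat H_i(x),$$ and let $T_{\mathrm{A3PM}}x$ be an $\varepsilon$-approximate projection of $x$ onto $\widehat\Omega(x)$. Then for all $s\in S$ and all $x\in\mathbb{R}^n$, $$\|T_{\mathrm{A3PM}}x-s\|^2\le\|x-s\|^2-(1-\varepsilon)^4\,\delta(x)^2 .$$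
   Context: For a nonempty closed convex set $X\subset\mathbb{R}^n$, $x\in\mathbb{R}^n$ and $\varepsilon\in[0,1)$, an $\varepsilon$-approximate projection of $x$ onto $X$ is a point $p=\widehat P_X(x,\varepsilon)\in\mathbb{R}^n$ such that $$\mathrm{dist}(p,X)\le\varepsilon\,\mathrm{dist}(x,X)\quad\text{and}\quad X\subseteq\{y\in\mathbb{R}^n:\langle y-p,\;x-p\rangle\le0\}.$$ $\delta(x):=\max_{1\le i\le m}\mathrm{dist}(x,U_i)$; $\|\cdot\|$ is the Euclidean norm associated with $\langle\cdot,\cdot\rangle$. *)

theory Defs
  imports "HOL-Analysis.Analysis"
begin

(* Meaningful for nonempty closed convex X and 0 <= eps < 1; note that
   infdist x {} = 0. An approximate projection is not unique, hence a relation. *)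
definition approx_proj :: "real \<Rightarrow> (real ^ 'n) set \<Rightarrow> real ^ 'n \<Rightarrow> real ^ 'n \<Rightarrow> bool"
  where "approx_proj eps X x p \<longleftrightarrow>
    infdist p X \<le> eps * infdist x X \<and> X \<subseteq> {y. (y - p) \<bullet> (x - p) \<le> 0}"

definition max_dist :: "nat \<Rightarrow> (nat \<Rightarrow> (real ^ 'n) set) \<Rightarrow> real ^ 'n \<Rightarrow> real"
  where "max_dist m U x = Max ((\<lambda>i. infdist x (U i)) ` {1..m})"

(* Half-space through p with outer normal x - p (the whole space if p = x). *)
definition sep_halfspace :: "real ^ 'n \<Rightarrow> real ^ 'n \<Rightarrow> (real ^ 'n) set"
  where "sep_halfspace x p = {y. (x - p) \<bullet> (y - p) \<le> 0}"

definition outer_polyhedron ::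
    "nat \<Rightarrow> (nat \<Rightarrow> real ^ 'n \<Rightarrow> real ^ 'n) \<Rightarrow> real ^ 'n \<Rightarrow> (real ^ 'n) set"
  where "outer_polyhedron m P x = (\<Inter>i\<in>{1..m}. sep_halfspace x (P i x))"

end

theory Submission
  imports Defs
begin

text \<open>
  An approximate projection \<open>p\<close> of \<open>x\<close> onto \<open>X\<close> has two useful properties. Its separating half-space
  makes the angle at \<open>p\<close> between \<open>x\<close> and any point of \<open>X\<close> non-acute, so the step from \<open>x\<close> to
  \<open>p\<close> decreases the squared distance to every point of \<open>X\<close> by at least the squared step length
  (\<open>approx_proj_pythagoras\<close>); and since \<open>p\<close> is within \<open>eps * infdist x X\<close> of \<open>X\<close>, the step
  has length at least \<open>(1 - eps) * infdist x X\<close> (\<open>approx_proj_step_length\<close>).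

  The second property is used twice. Applied to the projection onto \<open>U i\<close>, it shows that the
  half-space through \<open>P i x\<close> is at distance at least \<open>(1 - eps) * infdist x (U i)\<close> from \<open>x\<close>,
  because \<open>P i x\<close> is the point of that half-space nearest to \<open>x\<close>; hence so is the outer polyhedron. Applied
  to the projection onto the polyhedron, it contributes a second factor \<open>1 - eps\<close> to the length of the
  step from \<open>x\<close> to \<open>T x\<close>. Each point \<open>s\<close> common to the sets \<open>U i\<close> lies in the polyhedron, so
  the squared distance to \<open>s\<close> drops by the square of that length, whence the fourth power.
\<close>

text \<open>The triangle inequality: a short step would leave \<open>p\<close> too far from \<open>X\<close>.\<close>

lemma approx_proj_step_length:
  assumes "approx_proj eps X x p"
  shows "(1 - eps) * infdist x X \<le> dist x p"
proof -
  have "infdist x X \<le> infdist p X + dist x p"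
    by (rule infdist_triangle)
  with assms show ?thesis
    by (simp add: approx_proj_def algebra_simps)
qed

text \<open>The law of cosines in the triangle \<open>x\<close>, \<open>p\<close>, \<open>s\<close>, whose angle at \<open>p\<close> is non-acute.\<close>

lemma approx_proj_pythagoras:
  assumes "approx_proj eps X x p" and "s \<in> X"
  shows "(norm (p - s))\<^sup>2 \<le> (norm (x - s))\<^sup>2 - (dist x p)\<^sup>2"
proof -
  have "(s - p) \<bullet> (x - p) \<le> 0"
    using assms by (auto simp: approx_proj_def)
  moreover have "(norm (x - s))\<^sup>2 = (norm (x - p))\<^sup>2 + (norm (p - s))\<^sup>2 - 2 * ((s - p) \<bullet> (x - p))"
    by (simp add: power2_norm_eq_inner algebra_simps inner_commute)
  ultimately show ?thesis
    by (simp add: dist_norm)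
qed

text \<open>The point \<open>p\<close> is the metric projection of \<open>x\<close> onto the half-space: the component of \<open>x - y\<close>
  along \<open>x - p\<close> already has length at least \<open>dist x p\<close>.\<close>

lemma dist_le_sep_halfspace:
  assumes "y \<in> sep_halfspace x p"
  shows "dist x p \<le> dist x y"
proof (cases "x = p")
  case False
  have "(norm (x - p))\<^sup>2 \<le> (x - p) \<bullet> (x - y)"
    using assms by (simp add: sep_halfspace_def power2_norm_eq_inner algebra_simps)
  also have "\<dots> \<le> norm (x - p) * norm (x - y)"
    by (rule norm_cauchy_schwarz)
  finally show ?thesis
    using False by (simp add: power2_eq_square dist_norm)
qed simp

lemma approx_proj_subset_sep_halfspace:
  assumes "approx_proj eps X x p"
  shows "X \<subseteq> sep_halfspace x p"
  using assms by (auto simp: approx_proj_def sep_halfspace_def inner_commute)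

theorem mainTheorem7:
  fixes m :: nat
    and U :: "nat \<Rightarrow> (real ^ 'n) set"
    and eps :: real
    and P :: "nat \<Rightarrow> real ^ 'n \<Rightarrow> real ^ 'n"
    and T :: "real ^ 'n \<Rightarrow> real ^ 'n"
  assumes "m \<ge> 1"
    and "\<And>i. i \<in> {1..m} \<Longrightarrow> closed (U i)"
    and "\<And>i. i \<in> {1..m} \<Longrightarrow> convex (U i)"
    and "(\<Inter>i\<in>{1..m}. U i) \<noteq> {}"
    and "0 \<le> eps" and "eps < 1"
    and "\<And>x i. i \<in> {1..m} \<Longrightarrow> approx_proj eps (U i) x (P i x)"
    and "\<And>x. approx_proj eps (outer_polyhedron m P x) x (T x)"
  shows "\<forall>s \<in> (\<Inter>i\<in>{1..m}. U i). \<forall>x.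
    (norm (T x - s))\<^sup>2 \<le> (norm (x - s))\<^sup>2 - (1 - eps) ^ 4 * (max_dist m U x)\<^sup>2"
proof (intro ballI allI)
  fix s x
  assume s: "s \<in> (\<Inter>i\<in>{1..m}. U i)"
  let ?\<Omega> = "outer_polyhedron m P x"
  have s_in: "s \<in> ?\<Omega>"
    using s approx_proj_subset_sep_halfspace[OF assms(7)]
    by (fastforce simp: outer_polyhedron_def)
  have "max_dist m U x \<in> (\<lambda>i. infdist x (U i)) ` {1..m}"
    unfolding max_dist_def using \<open>m \<ge> 1\<close> by (intro Max_in) auto
  then obtain i where i: "i \<in> {1..m}" and max: "max_dist m U x = infdist x (U i)"
    by auto
  have "dist x (P i x) \<le> dist x y" if "y \<in> ?\<Omega>" for y
    using that i by (intro dist_le_sep_halfspace) (auto simp: outer_polyhedron_def)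
  \<comment> \<open>\<open>infdist x {} = 0\<close>, so the point \<open>s\<close> is what makes the next lower bound hold.\<close>
  then have "dist x (P i x) \<le> infdist x ?\<Omega>"
    using s_in unfolding infdist_def by (auto intro!: cINF_greatest)
  with approx_proj_step_length[OF assms(7)[OF i]]
  have "(1 - eps) * max_dist m U x \<le> infdist x ?\<Omega>"
    unfolding max by (rule order_trans)
  then have "(1 - eps) * ((1 - eps) * max_dist m U x) \<le> (1 - eps) * infdist x ?\<Omega>"
    using \<open>eps < 1\<close> by (intro mult_left_mono) auto
  also have "\<dots> \<le> dist x (T x)"
    by (rule approx_proj_step_length[OF assms(8)])
  finally have "((1 - eps)\<^sup>2 * max_dist m U x)\<^sup>2 \<le> (dist x (T x))\<^sup>2"
    using \<open>eps < 1\<close>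
    by (intro power_mono) (auto simp: power2_eq_square mult.assoc max infdist_nonneg)
  then have "(1 - eps) ^ 4 * (max_dist m U x)\<^sup>2 \<le> (dist x (T x))\<^sup>2"
    by (simp add: power_mult_distrib flip: power_mult)
  with approx_proj_pythagoras[OF assms(8) s_in]
  show "(norm (T x - s))\<^sup>2 \<le> (norm (x - s))\<^sup>2 - (1 - eps) ^ 4 * (max_dist m U x)\<^sup>2"
    by linarith
qed

end
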